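(* For every $n\in\mathbb{N}$, $$(-1)^n[2]_q^{2n+1}x(yyxx)^ny=(1-q^{-2})^{-1}\sum_{k=0}^{2n}(-1)^k[W_{k-2n},W_{k+1}]_q,$$ $$(-1)^n[2]_q^{2n+1}y(xxyy)^nx=(1-q^{-2})^{-1}\sum_{k=0}^{2n}(-1)^k[W_{k+1},W_{k-2n}]_q,$$ $$\sum_{k=0}^{2n+1}(-1)^kG_k\star\tilde{G}_{2n+1-k}=(1-q^{-2})^{-1}\sum_{k=0}^{2n}(-1)^k[W_{k-2n},W_{k+1}]=\sum_{k=0}^{2n+1}(-1)^k\tilde{G}_{2n+1-k}\star G_k.$$
   Context: Let $\mathbb{F}$ be a field of characteristic zero and let $q\in\mathbb{F}$ be nonzero and not a root of unity; $\mathbb{N}=\{0,1,2,\ldots\}$; $[2]_q=q+q^{-1}$. Let $\mathbb{V}$ be the free associative unital $\mathbb{F}$-algebra on two noncommuting generators (letters) $x,y$; the words in $x,y$ (including the trivial word $\mathbf{1}$) form a basis of $\mathbb{V}$. Words such as $(xxyy)^nx$ are written with respect to the free (concatenation) product. The $q$-shuffle product $\star$ on the vector space $\mathbb{V}$ is the bilinear associative product with unit $\mathbf{1}$ determined as follows. Put $\langle x,x\rangle=\langle y,y\rangle=2$ and $\langle x,y\rangle=\langle y,x\rangle=-2$. For nontrivial words $u=u_1\cdots u_r$ and $v=v_1\cdots v_s$, $$u\star v=u_1\big((u_2\cdots u_r)\star v\big)+v_1\big(u\star(v_2\cdots v_s)\big)q^{\langle v_1,u_1\rangle+\cdots+\langle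 v_1,u_r\rangle}.$$ The alternating words are, for $n\in\mathbb{N}$ (powers in the free product): $\tilde{G}_{n+1}=(xy)^{n+1}$, $G_{n+1}=(yx)^{n+1}$, $W_{-n}=(xy)^nx$, $W_{n+1}=(yx)^ny$; also $G_0=\tilde{G}_0=\mathbf{1}$. Commutators are taken with respect to $\star$: $[X,Y]=X\star Y-Y\star X$ and $[X,Y]_q=qX\star Y-q^{-1}Y\star X$. *)

theory Defs
  imports Complex_Main "HOL-Library.Poly_Mapping"
begin

datatype letter = LX | LY

text \<open>Lists under concatenation form the free monoid. Writing it additively makes
  finitely supported functions on words, with the convolution product \<open>*\<close> of
  \<^theory>\<open>HOL-Library.Poly_Mapping\<close>, the free associative unital algebra; the trivial word
  is its unit \<open>1\<close>, and \<open>*\<close> and \<open>^\<close> denote the free product and its powers.\<close>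

instantiation list :: (type) monoid_add
begin

definition zero_list :: "'a list" where
  "zero_list = []"

definition plus_list :: "'a list \<Rightarrow> 'a list \<Rightarrow> 'a list" where
  "plus_list u v = u @ v"

instance
  by standard (simp_all add: zero_list_def plus_list_def)

end

type_synonym 'a free_alg = "letter list \<Rightarrow>\<^sub>0 'a"

abbreviation word :: "letter list \<Rightarrow> 'a::field free_alg" where
  "word u \<equiv> Poly_Mapping.single u 1"

abbreviation gen_x :: "'a::field free_alg" where
  "gen_x \<equiv> word [LX]"

abbreviation gen_y :: "'a::field free_alg" where
  "gen_y \<equiv> word [LY]"

definition scale :: "'a::field \<Rightarrow> 'a free_alg \<Rightarrow> 'a free_alg" (infixr \<open>\<cdot>\<close> 75) where
  "c \<cdot> f = Poly_Mapping.map ((*) c) f"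

definition pairing :: "letter \<Rightarrow> letter \<Rightarrow> int" where
  "pairing a b = (if a = b then 2 else - 2)"

fun qshuffle_word :: "'a::field \<Rightarrow> letter list \<Rightarrow> letter list \<Rightarrow> 'a free_alg" where
  "qshuffle_word q [] v = word v"
| "qshuffle_word q (a # u) [] = word (a # u)"
| "qshuffle_word q (a # u) (b # v) =
     word [a] * qshuffle_word q u (b # v)
     + (q powi (\<Sum>c\<leftarrow>a # u. pairing b c)) \<cdot> (word [b] * qshuffle_word q (a # u) v)"

text \<open>The \<open>q\<close>-shuffle product: bilinear extension from the basis of words.\<close>

definition qshuffle :: "'a::field \<Rightarrow> 'a free_alg \<Rightarrow> 'a free_alg \<Rightarrow> 'a free_alg" where
  "qshuffle q f g =
     (\<Sum>u\<in>Poly_Mapping.keys f. \<Sum>v\<in>Poly_Mapping.keys g.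
        (Poly_Mapping.lookup f u * Poly_Mapping.lookup g v) \<cdot> qshuffle_word q u v)"

definition comm :: "'a::field \<Rightarrow> 'a free_alg \<Rightarrow> 'a free_alg \<Rightarrow> 'a free_alg" where
  "comm q f g = qshuffle q f g - qshuffle q g f"

definition qcomm :: "'a::field \<Rightarrow> 'a free_alg \<Rightarrow> 'a free_alg \<Rightarrow> 'a free_alg" where
  "qcomm q f g = q \<cdot> qshuffle q f g - inverse q \<cdot> qshuffle q g f"

definition alt_G :: "nat \<Rightarrow> 'a::field free_alg" where
  "alt_G n = (gen_y * gen_x) ^ n"

definition alt_Gt :: "nat \<Rightarrow> 'a::field free_alg" where
  "alt_Gt n = (gen_x * gen_y) ^ n"

text \<open>One integer-indexed family: for \<open>n \<ge> 0\<close>, \<open>alt_W (- n) = (xy)^n x\<close> and \<open>alt_W (n + 1) = (yx)^n y\<close>.\<close>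

definition alt_W :: "int \<Rightarrow> 'a::field free_alg" where
  "alt_W k = (if k \<le> 0 then (gen_x * gen_y) ^ nat (- k) * gen_x
              else (gen_y * gen_x) ^ nat (k - 1) * gen_y)"

end

theory Submission
  imports Defs
begin

text \<open>Let \<open>Gt(t)\<close>, \<open>G(t)\<close>, \<open>W\<^sup>-(t)\<close>, \<open>W\<^sup>+(t)\<close> be the generating functions in \<open>t\<^sup>n\<close> of \<open>alt_Gt n\<close>, \<open>alt_G n\<close>,
  \<open>alt_W (- n)\<close>, \<open>alt_W (n + 1)\<close>, and let \<open>A\<close>, \<open>B\<close>, \<open>C\<close>, \<open>D\<close> be the \<open>q\<close>-shuffle products \<open>Gt(-t) \<star> G(t)\<close>,
  \<open>W\<^sup>+(-t) \<star> G(t)\<close>, \<open>Gt(-t) \<star> W\<^sup>-(t)\<close>, \<open>W\<^sup>+(-t) \<star> W\<^sup>-(t)\<close>. Splitting off first letters gives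
  \<open>A = 1 - t x B + t y C\<close>, \<open>B = y (A + q\<^sup>2 t D)\<close>, \<open>C = x (A - t D)\<close>, \<open>D = y C + q\<^sup>-\<^sup>2 x B\<close>.
  Eliminating \<open>A\<close> and \<open>D\<close> leaves \<open>B = y (1 + (1 + q\<^sup>2) t y C)\<close> and \<open>C = x (1 - (1 + q\<^sup>-\<^sup>2) t x B)\<close>, whose
  even parts are geometric series in \<open>- [2]\<^sub>q\<^sup>2 t\<^sup>2 y y x x\<close> and \<open>- [2]\<^sub>q\<^sup>2 t\<^sup>2 x x y y\<close>. The products in the
  opposite order arise by exchanging \<open>x\<close> and \<open>y\<close>.\<close>

section \<open>Scalars and words in the free algebra\<close>

lemma lookup_scale [simp]: "Poly_Mapping.lookup (c \<cdot> f) w = c * Poly_Mapping.lookup f w"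
  by (simp add: scale_def Poly_Mapping.map.rep_eq when_def)

interpretation free_alg: vector_space "scale :: 'a::field \<Rightarrow> _"
  by unfold_locales
    (rule poly_mapping_eqI, simp add: lookup_add lookup_one algebra_simps)+

lemma scale_conv_mult: "c \<cdot> f = Poly_Mapping.single 0 c * f"
  by (simp add: scale_def mult_map_scale_conv_mult)

lemma word_mult_scale: "word u * (c \<cdot> f) = c \<cdot> (word u * f)"
proof -
  have "word u * Poly_Mapping.single 0 c = Poly_Mapping.single 0 c * word u"
    by (simp add: mult_single)
  then show ?thesis
    by (metis scale_conv_mult mult.assoc)
qed

lemma word_mult: "word u * word v = word (u @ v)"
  by (simp add: mult_single plus_list_def)

lemma word_Nil: "word [] = 1"
  by (metis single_one zero_list_def)

lemma qshuffle_word_word: "qshuffle q (word u) (word v) = qshuffle_word q u v"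
  by (simp add: qshuffle_def)

lemma qshuffle_word_Nil2 [simp]: "qshuffle_word q u [] = word u"
  by (cases u) auto

section \<open>Alternating words and their first-letter recursion\<close>

fun alternating :: "'b \<Rightarrow> 'b \<Rightarrow> nat \<Rightarrow> 'b list" where
  "alternating a b 0 = []"
| "alternating a b (Suc n) = a # alternating b a n"

lemma word_alternating_even: "(word [a] * word [b]) ^ n = word (alternating a b (2 * n))"
  by (induction n) (simp_all add: word_mult word_Nil)

lemma word_alternating_odd:
  "(word [a] * word [b]) ^ n * word [a] = word (alternating a b (Suc (2 * n)))"
  by (induction n) (simp_all add: word_mult word_Nil mult.assoc)

lemma alt_G_word: "alt_G n = word (alternating LY LX (2 * n))"
  unfolding alt_G_def by (rule word_alternating_even)

lemma alt_Gt_word: "alt_Gt n = word (alternating LX LY (2 * n))"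
  unfolding alt_Gt_def by (rule word_alternating_even)

lemma alt_W_nonpos: "alt_W (- int n) = word (alternating LX LY (Suc (2 * n)))"
  unfolding alt_W_def using word_alternating_odd[of LX LY n] by simp

lemma alt_W_pos: "alt_W (int n + 1) = word (alternating LY LX (Suc (2 * n)))"
  unfolding alt_W_def using word_alternating_odd[of LY LX n] by simp

text \<open>Neighbouring letters have opposite pairings with \<open>c\<close> and cancel; a word of
  odd length keeps one unpaired letter, equal to \<open>a\<close>.\<close>

lemma weight_alternating:
  assumes "a \<noteq> b"
  shows "(\<Sum>e\<leftarrow>alternating a b n. pairing c e) = (if even n then 0 else pairing c a)"
  using assms
proof (induction n arbitrary: a b)
  case (Suc n)
  have "pairing c a + pairing c b = 0"
    using Suc.prems by (cases a; cases b; cases c) (auto simp: pairing_def)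
  with Suc show ?case by auto
qed simp

text \<open>The letter \<open>c\<close> crosses all \<open>Suc m\<close> letters on the left, so its
  exponent vanishes exactly for odd \<open>m\<close>.\<close>

lemma qshuffle_word_alternating_Suc:
  assumes "a \<noteq> b"
  shows "qshuffle_word q (alternating a b (Suc m)) (alternating c d (Suc n)) =
    word [a] * qshuffle_word q (alternating b a m) (alternating c d (Suc n)) +
    (q powi (if even m then pairing c a else 0)) \<cdot>
      (word [c] * qshuffle_word q (alternating a b (Suc m)) (alternating d c n))"
  using weight_alternating[OF assms, of c "Suc m"] by simp

lemma word_mult_alternating: "word [a] * word (alternating b a n) = word (alternating a b (Suc n))"
  by (simp add: word_mult)

lemmas [simp del] = alternating.simps(2) qshuffle_word.simps(3)

section \<open>Signed convolutions, the coefficients of the products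
  \<open>u(-t) \<star> v(t)\<close>\<close>

definition signed_conv ::
    "'a::field \<Rightarrow> (nat \<Rightarrow> letter list) \<Rightarrow> (nat \<Rightarrow> letter list) \<Rightarrow> nat \<Rightarrow> 'a free_alg" where
  "signed_conv q u v m = (\<Sum>i\<le>m. (-1) ^ i \<cdot> qshuffle_word q (u i) (v (m - i)))"

text \<open>With letters \<open>LX LY\<close>, \<open>evens\<close> and \<open>odds\<close> give the
  words of \<open>Gt\<close> and \<open>W\<^sup>-\<close>; with \<open>LY LX\<close>, those of
  \<open>G\<close> and \<open>W\<^sup>+\<close>.\<close>

abbreviation evens :: "letter \<Rightarrow> letter \<Rightarrow> nat \<Rightarrow> letter list" where
  "evens a b n \<equiv> alternating a b (2 * n)"

abbreviation odds :: "letter \<Rightarrow> letter \<Rightarrow> nat \<Rightarrow> letter list" where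
  "odds a b n \<equiv> alternating a b (Suc (2 * n))"

lemma word_mult_signed_conv:
  "word w * signed_conv q u v m = (\<Sum>i\<le>m. (-1) ^ i \<cdot> (word w * qshuffle_word q (u i) (v (m - i))))"
  by (simp add: signed_conv_def sum_distrib_left word_mult_scale)

context
  fixes a b :: letter and q :: "'a::field"
  assumes ab: "a \<noteq> b"
begin

lemma pairing_ab: "pairing a b = - 2" "pairing b a = - 2" "pairing a a = 2" "pairing b b = 2"
  using ab by (auto simp: pairing_def)

text \<open>The equation for \<open>A\<close>, with \<open>a\<close>, \<open>b\<close> as
  \<open>x\<close>, \<open>y\<close>. Taking the left letter \<open>a\<close> lowers
  \<open>i\<close> and flips the sign; the right letter \<open>b\<close> crosses a word of even
  length, so no power of \<open>q\<close> appears.\<close>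

lemma signed_conv_even_even:
  "signed_conv q (evens a b) (evens b a) (Suc m) =
    word [b] * signed_conv q (evens a b) (odds a b) m - word [a] * signed_conv q (odds b a) (evens b a) m"
proof -
  define g h where "g i = word [a] * qshuffle_word q (odds b a i) (evens b a (m - i))"
    and "h i = word [b] * qshuffle_word q (evens a b i) (odds a b (m - i))" for i
  \<comment> \<open>The left word is empty at \<open>i = 0\<close> and the right one at
    \<open>i = Suc m\<close>, so each end loses one term.\<close>
  have step: "qshuffle_word q (evens a b i) (evens b a (Suc m - i)) =
      (case i of 0 \<Rightarrow> 0 | Suc j \<Rightarrow> g j) + (if i = Suc m then 0 else h i)" if "i \<le> Suc m" for i
  proof (cases i)
    case 0
    then show ?thesis by (simp add: h_def word_mult_alternating)
  next
    case i: (Suc j)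
    show ?thesis
    proof (cases "i = Suc m")
      case True
      then show ?thesis using i by (simp add: g_def word_mult_alternating)
    next
      case False
      define l where "l = m - i"
      have l: "Suc m - i = Suc l" "m - j = Suc l" "m - Suc j = l" using False that i by (auto simp: l_def)
      show ?thesis
        using qshuffle_word_alternating_Suc[OF ab, of q "Suc (2 * j)" b a "Suc (2 * l)"] False
        by (simp add: g_def h_def i l)
    qed
  qed
  have "signed_conv q (evens a b) (evens b a) (Suc m) =
      (\<Sum>i\<le>Suc m. (-1) ^ i \<cdot> (case i of 0 \<Rightarrow> 0 | Suc j \<Rightarrow> g j)) +
      (\<Sum>i\<le>Suc m. (-1) ^ i \<cdot> (if i = Suc m then 0 else h i))"
    unfolding signed_conv_def sum.distrib [symmetric] free_alg.scale_right_distrib [symmetric]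
    by (intro sum.cong refl arg_cong [where f = "(\<cdot>) _"] step) simp
  also have "(\<Sum>i\<le>Suc m. (-1) ^ i \<cdot> (case i of 0 \<Rightarrow> 0 | Suc j \<Rightarrow> g j)) = - (\<Sum>i\<le>m. (-1) ^ i \<cdot> g i)"
    by (subst sum.atMost_Suc_shift) (simp add: sum_negf)
  also have "(\<Sum>i\<le>Suc m. (-1) ^ i \<cdot> (if i = Suc m then 0 else h i)) = (\<Sum>i\<le>m. (-1) ^ i \<cdot> h i)"
    by simp
  finally show ?thesis by (simp add: word_mult_signed_conv g_def h_def)
qed

text \<open>The equation for \<open>B\<close>. Both words start with \<open>b\<close>; the right
  \<open>b\<close> crosses a left word of weight 2, and is absent at
  \<open>i = Suc m\<close>.\<close>

lemma signed_conv_odd_even: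
  "signed_conv q (odds b a) (evens b a) (Suc m) =
    word [b] * signed_conv q (evens a b) (evens b a) (Suc m) +
    q\<^sup>2 \<cdot> (word [b] * signed_conv q (odds b a) (odds a b) m)"
proof -
  define g h where "g i = word [b] * qshuffle_word q (evens a b i) (evens b a (Suc m - i))"
    and "h i = word [b] * qshuffle_word q (odds b a i) (odds a b (m - i))" for i
  have step: "qshuffle_word q (odds b a i) (evens b a (Suc m - i)) =
      g i + (if i = Suc m then 0 else q\<^sup>2 \<cdot> h i)" if "i \<le> Suc m" for i
  proof (cases "i = Suc m")
    case True
    then show ?thesis by (simp add: g_def word_mult_alternating)
  next
    case False
    define l where "l = m - i"
    have l: "Suc m - i = Suc l" "m - i = l" using False that by (auto simp: l_def)
    show ?thesis
      using qshuffle_word_alternating_Suc[OF ab[symmetric], of q "2 * i" b a "Suc (2 * l)"] False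
      by (simp add: g_def h_def l pairing_ab)
  qed
  have "signed_conv q (odds b a) (evens b a) (Suc m) =
      (\<Sum>i\<le>Suc m. (-1) ^ i \<cdot> g i) + (\<Sum>i\<le>Suc m. (-1) ^ i \<cdot> (if i = Suc m then 0 else q\<^sup>2 \<cdot> h i))"
    unfolding signed_conv_def sum.distrib [symmetric] free_alg.scale_right_distrib [symmetric]
    by (intro sum.cong refl arg_cong [where f = "(\<cdot>) _"] step) simp
  also have "(\<Sum>i\<le>Suc m. (-1) ^ i \<cdot> (if i = Suc m then 0 else q\<^sup>2 \<cdot> h i)) = q\<^sup>2 \<cdot> (\<Sum>i\<le>m. (-1) ^ i \<cdot> h i)"
    by (simp add: free_alg.scale_sum_right mult.commute)
  finally show ?thesis by (simp only: word_mult_signed_conv g_def h_def)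
qed

text \<open>The equation for \<open>C\<close>. Both words start with \<open>a\<close>; the left
  \<open>a\<close> lowers \<open>i\<close> and flips the sign, the right \<open>a\<close> crosses a
  word of even length.\<close>

lemma signed_conv_even_odd:
  "signed_conv q (evens a b) (odds a b) (Suc m) =
    word [a] * signed_conv q (evens a b) (evens b a) (Suc m) -
    word [a] * signed_conv q (odds b a) (odds a b) m"
proof -
  define g h where "g i = word [a] * qshuffle_word q (evens a b i) (evens b a (Suc m - i))"
    and "h i = word [a] * qshuffle_word q (odds b a i) (odds a b (m - i))" for i
  have step: "qshuffle_word q (evens a b i) (odds a b (Suc m - i)) =
      g i + (case i of 0 \<Rightarrow> 0 | Suc j \<Rightarrow> h j)" for i
  proof (cases i)
    case 0
    then show ?thesis by (simp add: g_def word_mult_alternating)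
  next
    case i: (Suc j)
    show ?thesis
      using qshuffle_word_alternating_Suc[OF ab, of q "Suc (2 * j)" a b "2 * (m - j)"]
      by (simp add: g_def h_def i)
  qed
  have "signed_conv q (evens a b) (odds a b) (Suc m) =
      (\<Sum>i\<le>Suc m. (-1) ^ i \<cdot> g i) + (\<Sum>i\<le>Suc m. (-1) ^ i \<cdot> (case i of 0 \<Rightarrow> 0 | Suc j \<Rightarrow> h j))"
    by (simp only: signed_conv_def step free_alg.scale_right_distrib sum.distrib)
  also have "(\<Sum>i\<le>Suc m. (-1) ^ i \<cdot> (case i of 0 \<Rightarrow> 0 | Suc j \<Rightarrow> h j)) = - (\<Sum>i\<le>m. (-1) ^ i \<cdot> h i)"
    by (subst sum.atMost_Suc_shift) (simp add: sum_negf)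
  finally show ?thesis by (simp only: word_mult_signed_conv g_def h_def add_uminus_conv_diff)
qed

text \<open>The equation for \<open>D\<close>. Both words are nonempty, so there are no boundary
  cases; the right \<open>a\<close> crosses a word of weight -2.\<close>

lemma signed_conv_odd_odd:
  "signed_conv q (odds b a) (odds a b) m =
    word [b] * signed_conv q (evens a b) (odds a b) m +
    inverse (q\<^sup>2) \<cdot> (word [a] * signed_conv q (odds b a) (evens b a) m)"
proof -
  have step: "qshuffle_word q (odds b a i) (odds a b (m - i)) =
      word [b] * qshuffle_word q (evens a b i) (odds a b (m - i)) +
      inverse (q\<^sup>2) \<cdot> (word [a] * qshuffle_word q (odds b a i) (evens b a (m - i)))" for i
    using qshuffle_word_alternating_Suc[OF ab[symmetric], of q "2 * i" a b "2 * (m - i)"]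
    by (simp add: pairing_ab power_int_minus)
  have "signed_conv q (odds b a) (odds a b) m =
     (\<Sum>i\<le>m. (-1) ^ i \<cdot> (word [b] * qshuffle_word q (evens a b i) (odds a b (m - i)))) +
     inverse (q\<^sup>2) \<cdot> (\<Sum>i\<le>m. (-1) ^ i \<cdot> (word [a] * qshuffle_word q (odds b a i) (evens b a (m - i))))"
    by (simp only: signed_conv_def step free_alg.scale_right_distrib sum.distrib
        free_alg.scale_sum_right free_alg.scale_scale mult.commute [of "(-1) ^ i" "inverse (q\<^sup>2)" for i])
  then show ?thesis by (simp only: word_mult_signed_conv)
qed

section \<open>Elimination and closed forms\<close>

context
  assumes q0: "q \<noteq> 0"
begin

text \<open>After substituting for \<open>A\<close> and \<open>D\<close>, the terms in
  \<open>B\<close> cancel because \<open>q\<^sup>2 * inverse (q\<^sup>2) = 1\<close>, and the terms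
  in \<open>C\<close> add up.\<close>

lemma signed_conv_odd_even_Suc:
  "signed_conv q (odds b a) (evens b a) (Suc m) =
    (1 + q\<^sup>2) \<cdot> (word [b] * word [b] * signed_conv q (evens a b) (odds a b) m)"
  unfolding signed_conv_odd_even signed_conv_even_even signed_conv_odd_odd
  using q0 by (simp add: algebra_simps word_mult_scale)

text \<open>Here the terms in \<open>C\<close> cancel and those in \<open>B\<close> add up.\<close>

lemma signed_conv_even_odd_Suc:
  "signed_conv q (evens a b) (odds a b) (Suc m) =
    (- (1 + inverse (q\<^sup>2))) \<cdot> (word [a] * word [a] * signed_conv q (odds b a) (evens b a) m)"
  unfolding signed_conv_even_odd signed_conv_even_even signed_conv_odd_odd
  by (simp add: algebra_simps word_mult_scale)

lemma two_q_squared: "(1 + q\<^sup>2) * (- (1 + inverse (q\<^sup>2))) = - (q + inverse q)\<^sup>2"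
  using q0 by (simp add: field_simps power2_eq_square)

text \<open>One use of each recurrence leads from \<open>2 * Suc n\<close> back to
  \<open>2 * n\<close>, with prefix \<open>bbaa\<close> and ratio
  \<open>- [2]\<^sub>q\<^sup>2\<close>; the series starts at the single letter
  \<open>b\<close>.\<close>

lemma signed_conv_odd_even_closed:
  "signed_conv q (odds b a) (evens b a) (2 * n) =
    (- (q + inverse q)\<^sup>2) ^ n \<cdot> ((word [b] * word [b] * word [a] * word [a]) ^ n * word [b])"
proof (induction n)
  case 0
  show ?case by (simp add: signed_conv_def alternating.simps)
next
  case (Suc n)
  have "signed_conv q (odds b a) (evens b a) (2 * Suc n) =
      (1 + q\<^sup>2) \<cdot> (word [b] * word [b] * (- (1 + inverse (q\<^sup>2))) \<cdot> (word [a] * word [a] *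
        signed_conv q (odds b a) (evens b a) (2 * n)))"
    by (simp only: mult_Suc_right add_2_eq_Suc signed_conv_odd_even_Suc signed_conv_even_odd_Suc)
  also have "\<dots> = (- (q + inverse q)\<^sup>2) \<cdot> (word [b] * word [b] * word [a] * word [a] *
        signed_conv q (odds b a) (evens b a) (2 * n))"
    by (simp only: two_q_squared [symmetric] word_mult_scale mult.assoc free_alg.scale_scale)
  finally show ?case
    by (simp only: Suc.IH word_mult_scale mult.assoc free_alg.scale_scale power_Suc)
qed

lemma signed_conv_even_odd_closed:
  "signed_conv q (evens a b) (odds a b) (2 * n) =
    (- (q + inverse q)\<^sup>2) ^ n \<cdot> ((word [a] * word [a] * word [b] * word [b]) ^ n * word [a])"
proof (induction n)
  case 0
  show ?case by (simp add: signed_conv_def alternating.simps)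
next
  case (Suc n)
  have "signed_conv q (evens a b) (odds a b) (2 * Suc n) =
      (- (1 + inverse (q\<^sup>2))) \<cdot> (word [a] * word [a] * (1 + q\<^sup>2) \<cdot> (word [b] * word [b] *
        signed_conv q (evens a b) (odds a b) (2 * n)))"
    by (simp only: mult_Suc_right add_2_eq_Suc signed_conv_odd_even_Suc signed_conv_even_odd_Suc)
  also have "\<dots> = ((1 + q\<^sup>2) * (- (1 + inverse (q\<^sup>2)))) \<cdot> (word [a] * word [a] * word [b] * word [b] *
        signed_conv q (evens a b) (odds a b) (2 * n))"
    by (simp only: word_mult_scale mult.assoc free_alg.scale_scale mult.commute [of "1 + q\<^sup>2"])
  finally show ?case
    by (simp only: two_q_squared Suc.IH word_mult_scale mult.assoc free_alg.scale_scale power_Suc)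
qed

end

end

text \<open>For \<open>LX LY\<close> this is one factor \<open>[2]\<^sub>q\<close> short of the left
  side of the first identity, the normalization the closed forms produce.\<close>

definition snake :: "'a::field \<Rightarrow> letter \<Rightarrow> letter \<Rightarrow> nat \<Rightarrow> 'a free_alg" where
  "snake q a b n = (- (q + inverse q)\<^sup>2) ^ n \<cdot>
    (word [a] * (word [b] * word [b] * word [a] * word [a]) ^ n * word [b])"

text \<open>Prefixing \<open>b\<close> to the closed form of \<open>C\<close> and \<open>a\<close>
  to that of \<open>B\<close> yields the two snakes.\<close>

lemma signed_conv_odd_odd_snake:
  assumes "a \<noteq> b" "q \<noteq> 0"
  shows "signed_conv q (odds b a) (odds a b) (2 * n) = snake q b a n + inverse (q\<^sup>2) \<cdot> snake q a b n"
  by (simp only: signed_conv_odd_odd[OF assms(1)] signed_conv_odd_even_closed[OF assms]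
      signed_conv_even_odd_closed[OF assms] snake_def word_mult_scale mult.assoc)

lemma signed_conv_even_even_snake:
  assumes "a \<noteq> b" "q \<noteq> 0"
  shows "signed_conv q (evens a b) (evens b a) (Suc (2 * n)) = snake q b a n - snake q a b n"
  by (simp only: signed_conv_even_even[OF assms(1)] signed_conv_odd_even_closed[OF assms]
      signed_conv_even_odd_closed[OF assms] snake_def word_mult_scale mult.assoc)

section \<open>The sums of the theorem as signed convolutions\<close>

lemma alt_W_diff:
  assumes "k \<le> 2 * n"
  shows "alt_W (int k - 2 * int n) = word (odds LX LY (2 * n - k))"
proof -
  have "int k - 2 * int n = - int (2 * n - k)" using assms by simp
  then show ?thesis by (simp only: alt_W_nonpos)
qed

text \<open>The left index is \<open>2 * n - k\<close>, so the sum is reversed; it has the parity of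
  \<open>k\<close>, hence the signs agree.\<close>

lemma sum_W_nonpos_W_pos:
  "(\<Sum>k = 0..2 * n. (-1) ^ k \<cdot> qshuffle q (alt_W (int k - 2 * int n)) (alt_W (int k + 1))) =
    signed_conv q (odds LX LY) (odds LY LX) (2 * n)"
  unfolding signed_conv_def atMost_atLeast0
  by (rule sum.reindex_bij_witness[of _ "\<lambda>i. 2 * n - i" "\<lambda>i. 2 * n - i"])
    (simp_all add: alt_W_diff alt_W_pos qshuffle_word_word minus_one_power_iff)

lemma sum_W_pos_W_nonpos:
  "(\<Sum>k = 0..2 * n. (-1) ^ k \<cdot> qshuffle q (alt_W (int k + 1)) (alt_W (int k - 2 * int n))) =
    signed_conv q (odds LY LX) (odds LX LY) (2 * n)"
  unfolding signed_conv_def atMost_atLeast0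
  by (rule sum.cong) (simp_all add: alt_W_diff alt_W_pos qshuffle_word_word)

lemma sum_G_Gt:
  "(\<Sum>k = 0..m. (-1) ^ k \<cdot> qshuffle q (alt_G k) (alt_Gt (m - k))) =
    signed_conv q (evens LY LX) (evens LX LY) m"
  by (simp only: signed_conv_def atMost_atLeast0 alt_G_word alt_Gt_word qshuffle_word_word)

text \<open>For odd \<open>m\<close> the left index \<open>m - k\<close> has parity opposite to
  \<open>k\<close>, so reversal costs a global sign.\<close>

lemma sum_Gt_G:
  assumes "odd m"
  shows "(\<Sum>k = 0..m. (-1) ^ k \<cdot> qshuffle q (alt_Gt (m - k)) (alt_G k)) =
    - signed_conv q (evens LX LY) (evens LY LX) m"
proof -
  have "(\<Sum>k\<le>m. (-1) ^ k \<cdot> qshuffle q (alt_Gt (m - k)) (alt_G k)) =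
      (\<Sum>i\<le>m. - ((-1) ^ i \<cdot> qshuffle_word q (evens LX LY i) (evens LY LX (m - i))))"
  proof (rule sum.reindex_bij_witness[of _ "\<lambda>i. m - i" "\<lambda>i. m - i"])
    fix k assume k: "k \<in> {..m}"
    have "(-1) ^ (m - k) = - ((-1) ^ k :: 'a)"
      using k assms by (simp add: minus_one_power_iff)
    moreover have "m - (m - k) = k" using k by simp
    ultimately show "- ((-1) ^ (m - k) \<cdot> qshuffle_word q (evens LX LY (m - k)) (evens LY LX (m - (m - k)))) =
        (-1) ^ k \<cdot> qshuffle q (alt_Gt (m - k)) (alt_G k)"
      by (simp add: alt_G_word alt_Gt_word qshuffle_word_word)
  qed auto
  then show ?thesis by (simp only: signed_conv_def atMost_atLeast0 sum_negf)
qed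

section \<open>Commutator sums and the final identities\<close>

lemma sum_qcomm:
  "(\<Sum>k\<in>A. c k \<cdot> qcomm q (f k) (g k)) =
    q \<cdot> (\<Sum>k\<in>A. c k \<cdot> qshuffle q (f k) (g k)) - inverse q \<cdot> (\<Sum>k\<in>A. c k \<cdot> qshuffle q (g k) (f k))"
  by (simp add: qcomm_def free_alg.scale_right_diff_distrib sum_subtractf free_alg.scale_sum_right mult.commute)

lemma sum_comm:
  "(\<Sum>k\<in>A. c k \<cdot> comm q (f k) (g k)) =
    (\<Sum>k\<in>A. c k \<cdot> qshuffle q (f k) (g k)) - (\<Sum>k\<in>A. c k \<cdot> qshuffle q (g k) (f k))"
  by (simp add: comm_def free_alg.scale_right_diff_distrib sum_subtractf)

text \<open>The two occurrences of \<open>snake q b a n\<close> cancel; \<open>snake q a b n\<close>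
  gets \<open>q - q^-3 = (1 - q^-2) * (q + q^-1)\<close>, which supplies the missing factor
  \<open>[2]\<^sub>q\<close>.\<close>

lemma qcomm_snake:
  assumes "q \<noteq> 0" "q\<^sup>2 \<noteq> 1"
  shows "((-1) ^ n * (q + inverse q) ^ (2 * n + 1)) \<cdot>
      (word [a] * (word [b] * word [b] * word [a] * word [a]) ^ n * word [b]) =
    inverse (1 - q powi (-2)) \<cdot>
      (q \<cdot> (snake q a b n + inverse (q\<^sup>2) \<cdot> snake q b a n)
        - inverse q \<cdot> (snake q b a n + inverse (q\<^sup>2) \<cdot> snake q a b n))"
proof -
  have "1 - q powi (-2) \<noteq> 0"
    using assms by (simp add: power_int_minus)
  moreover have "inverse (q\<^sup>2) = q powi (-2)" by (simp add: power_int_minus)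
  moreover have "(-1) ^ n * (q + inverse q) ^ (2 * n + 1) = (q + inverse q) * (- (q + inverse q)\<^sup>2) ^ n"
    by (simp add: power_mult power_minus[of "(q + inverse q)\<^sup>2"])
  then have "((-1) ^ n * (q + inverse q) ^ (2 * n + 1)) \<cdot>
      (word [a] * (word [b] * word [b] * word [a] * word [a]) ^ n * word [b]) = (q + inverse q) \<cdot> snake q a b n"
    by (simp add: snake_def)
  moreover have "q - inverse q * inverse (q\<^sup>2) = (1 - inverse (q\<^sup>2)) * (q + inverse q)"
      "q * inverse (q\<^sup>2) = inverse q"
    using assms by (simp_all add: field_simps power2_eq_square)
  then have "q \<cdot> (snake q a b n + inverse (q\<^sup>2) \<cdot> snake q b a n)
        - inverse q \<cdot> (snake q b a n + inverse (q\<^sup>2) \<cdot> snake q a b n) =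
      ((1 - inverse (q\<^sup>2)) * (q + inverse q)) \<cdot> snake q a b n"
    by (simp add: free_alg.scale_right_distrib flip: free_alg.scale_left_diff_distrib)
  ultimately show ?thesis by simp
qed

theorem corollary5p11:
  fixes q :: "'a::field_char_0" and n :: nat
  assumes "q \<noteq> 0" and "\<forall>m::nat. m > 0 \<longrightarrow> q ^ m \<noteq> 1"
  shows
    "(((-1) ^ n * (q + inverse q) ^ (2 * n + 1))
        \<cdot> (gen_x * (gen_y * gen_y * gen_x * gen_x) ^ n * gen_y)
      = inverse (1 - q powi (-2))
        \<cdot> (\<Sum>k = 0..2 * n. (-1) ^ k \<cdot> qcomm q (alt_W (int k - 2 * int n)) (alt_W (int k + 1)))) \<and>
    (((-1) ^ n * (q + inverse q) ^ (2 * n + 1))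
        \<cdot> (gen_y * (gen_x * gen_x * gen_y * gen_y) ^ n * gen_x)
      = inverse (1 - q powi (-2))
        \<cdot> (\<Sum>k = 0..2 * n. (-1) ^ k \<cdot> qcomm q (alt_W (int k + 1)) (alt_W (int k - 2 * int n)))) \<and>
    ((\<Sum>k = 0..2 * n + 1. (-1) ^ k \<cdot> qshuffle q (alt_G k) (alt_Gt (2 * n + 1 - k)))
      = inverse (1 - q powi (-2))
        \<cdot> (\<Sum>k = 0..2 * n. (-1) ^ k \<cdot> comm q (alt_W (int k - 2 * int n)) (alt_W (int k + 1)))) \<and>
    (inverse (1 - q powi (-2))
        \<cdot> (\<Sum>k = 0..2 * n. (-1) ^ k \<cdot> comm q (alt_W (int k - 2 * int n)) (alt_W (int k + 1)))
      = (\<Sum>k = 0..2 * n + 1. (-1) ^ k \<cdot> qshuffle q (alt_Gt (2 * n + 1 - k)) (alt_G k)))"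
proof -
  let ?X = "snake q LX LY n" and ?Y = "snake q LY LX n"
  \<comment> \<open>The case \<open>m = 2\<close> makes \<open>1 - q powi (-2)\<close>
    invertible.\<close>
  have q2: "q\<^sup>2 \<noteq> 1" using assms(2) by simp
  have W: "signed_conv q (odds LX LY) (odds LY LX) (2 * n) = ?X + inverse (q\<^sup>2) \<cdot> ?Y"
      "signed_conv q (odds LY LX) (odds LX LY) (2 * n) = ?Y + inverse (q\<^sup>2) \<cdot> ?X"
    \<comment> \<open>Exchanging the letters negates the difference of snakes, which offsets the
      sign from the reversed sum.\<close>
    and G: "signed_conv q (evens LY LX) (evens LX LY) (2 * n + 1) = ?X - ?Y"
      "- signed_conv q (evens LX LY) (evens LY LX) (2 * n + 1) = ?X - ?Y"
    using assms(1) by (simp_all add: signed_conv_odd_odd_snake signed_conv_even_even_snake)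
  have o: "odd (2 * n + 1)" by simp
  \<comment> \<open>Both sums of \<open>G\<close> and \<open>Gt\<close> equal
    \<open>?X - ?Y\<close>, so this evaluation of the commutator sum settles both
    equalities.\<close>
  have c: "inverse (1 - q powi (-2)) \<cdot> ((?X + inverse (q\<^sup>2) \<cdot> ?Y) - (?Y + inverse (q\<^sup>2) \<cdot> ?X)) = ?X - ?Y"
  proof -
    have "(?X + inverse (q\<^sup>2) \<cdot> ?Y) - (?Y + inverse (q\<^sup>2) \<cdot> ?X) = (1 - inverse (q\<^sup>2)) \<cdot> (?X - ?Y)"
      by (simp add: free_alg.scale_left_diff_distrib free_alg.scale_right_diff_distrib)
    then show ?thesis using q2 by (simp add: power_int_minus)
  qed
  show ?thesis
    unfolding sum_qcomm sum_comm sum_W_nonpos_W_pos sum_W_pos_W_nonpos sum_G_Gt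
      sum_Gt_G[OF o] W G c
    using qcomm_snake[OF assms(1) q2] by simp
qed

end
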